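(* Let $X$ be a $\mathbb Z_+$-valued random variable and let $(m,r)$ and $(m',r')$ be in $\mathcal R$. Then $$(m,r)\odot\bigl((m',r')\odot X\bigr)\overset{d}{=}\bigl((m,r)\ast(m',r')\bigr)\odot X .$$
   Context: $\mathcal R=\{(m,r)\in\mathbb R^2: r\ge 0,\ 0<m\le r+1\}$. For $(m,r)\in\mathcal R$, $\psi_{m,r}(s)=1-m\frac{1-s}{1+r(1-s)}$, $s\in[0,1]$ (a probability generating function, pgf). The binary operation $\ast$ on $\mathcal R$ is $(m,r)\ast(m',r')=(mm',\,r+r'm)$. For a $\mathbb Z_+$-valued random variable $X$ and $(m,r)\in\mathcal R$, $(m,r)\odot X=\sum_{i=1}^X Z_i$ (empty sum $=0$), where $\{Z_i\}$ is a sequence of iid $\mathbb Z_+$-valued random variables, independent of $X$, with common pgf $\psi_{m,r}$. When operators are iterated, the sequence used in the outer operation is independent of the random variable to which it is applied. $\overset{d}{=}$ denotes equality in distribution. *)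

theory Defs
  imports "HOL-Probability.Probability"
begin

definition param_set :: "(real \<times> real) set" where
  "param_set = {(m, r). 0 \<le> r \<and> 0 < m \<and> m \<le> r + 1}"

fun param_mult :: "real \<times> real \<Rightarrow> real \<times> real \<Rightarrow> real \<times> real" (infixl "\<star>" 70) where
  "(m, r) \<star> (m', r') = (m * m', r + r' * m)"

lemma param_mult_closed:
  assumes "p \<in> param_set" and "q \<in> param_set"
  shows "p \<star> q \<in> param_set"
proof -
  obtain m r m' r' where eq: "p = (m, r)" "q = (m', r')"
    by (cases p, cases q)
  with assms have h: "0 \<le> r" "0 < m" "m \<le> r + 1" "0 \<le> r'" "0 < m'" "m' \<le> r' + 1"
    by (auto simp: param_set_def)
  have "m * m' \<le> m * (r' + 1)"
    using h by (intro mult_left_mono) auto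
  with h show ?thesis
    by (auto simp: eq param_set_def algebra_simps)
qed

fun psi :: "real \<times> real \<Rightarrow> real \<Rightarrow> real" where
  "psi (m, r) s = 1 - m * ((1 - s) / (1 + r * (1 - s)))"

definition pgf :: "'a measure \<Rightarrow> ('a \<Rightarrow> nat) \<Rightarrow> real \<Rightarrow> real" where
  "pgf M X s = integral\<^sup>L M (\<lambda>\<omega>. s ^ X \<omega>)"

definition iid :: "'a measure \<Rightarrow> (nat \<Rightarrow> 'a \<Rightarrow> nat) \<Rightarrow> bool" where
  "iid M Z \<longleftrightarrow>
     prob_space.indep_vars M (\<lambda>_. count_space UNIV) Z UNIV \<and>
     (\<forall>i j. distr M (count_space UNIV) (Z i) = distr M (count_space UNIV) (Z j))"

text \<open>
  Independence of \<open>X\<close> and the sequence \<open>Z\<close> means independence of \<open>X\<close> from the whole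
  process \<open>Z\<close>, viewed as one random element of the product space of sequences; it is
  not just independence of \<open>X\<close> from each single \<open>Z i\<close>. It is stated through
  the generated sigma-algebras because \<^const>\<open>prob_space.indep_var\<close> needs both
  variables to take values in the same type.
\<close>

definition thinning_seq ::
    "'a measure \<Rightarrow> real \<times> real \<Rightarrow> ('a \<Rightarrow> nat) \<Rightarrow> (nat \<Rightarrow> 'a \<Rightarrow> nat) \<Rightarrow> bool" where
  "thinning_seq M p X Z \<longleftrightarrow>
     iid M Z \<and>
     (\<forall>i. \<forall>s\<in>{0..1}. pgf M (Z i) s = psi p s) \<and>
     prob_space.indep_set M
       {X -` A \<inter> space M | A. A \<in> sets (count_space UNIV)}
       {(\<lambda>\<omega> i. Z i \<omega>) -` B \<inter> space M | B. B \<in> sets (Pi\<^sub>M UNIV (\<lambda>_. count_space UNIV))}"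

text \<open>
  When \<open>thinning_seq M p X Z\<close> holds, \<open>thin Z X\<close> is a version of \<open>p \<odot> X\<close>, the
  operator being determined only up to the choice of \<open>Z\<close>. Sequences start at index
  \<open>0\<close>, so the first \<open>X \<omega>\<close> terms are those with \<open>i < X \<omega>\<close>.
\<close>

definition thin :: "(nat \<Rightarrow> 'a \<Rightarrow> nat) \<Rightarrow> ('a \<Rightarrow> nat) \<Rightarrow> 'a \<Rightarrow> nat" where
  "thin Z X \<omega> = (\<Sum>i<X \<omega>. Z i \<omega>)"

end

theory Submission
  imports Defs "HOL-Complex_Analysis.Cauchy_Integral_Formula"
begin

text \<open>
  A \<open>\<nat>\<close>-valued random variable is determined in law by its probability generating function,
  and thinning acts on generating functions by composition: conditioning on \<open>X = n\<close>, which the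
  independence of \<open>X\<close> from the whole sequence permits, turns \<open>s ^ (\<Sum>i<n. Z i)\<close> into the \<open>n\<close>-th
  power of the common generating function of the \<open>Z i\<close>, so that
  \<open>pgf (thin Z X) s = pgf X (psi p s)\<close> (lemma \<open>pgf_thin\<close>).

  Two successive thinnings of \<open>X\<close> therefore have generating function
  \<open>pgf X (psi (m', r') (psi (m, r) s))\<close>. The maps \<open>psi\<close> are linear fractional, and in the variable
  \<open>u = 1 - s\<close> they read \<open>u \<mapsto> m u / (1 + r u)\<close>; composing them multiplies the parameters in the
  sense of \<open>\<star>\<close> (lemma \<open>psi_psi\<close>). Hence both sides of the claim have the same generating function,
  and lemma \<open>distr_eqI_pgf\<close> concludes.
\<close>

section \<open>The generating functions \<open>psi\<close>\<close>

lemma psi_in_unit_interval: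
  assumes "p \<in> param_set" and "s \<in> {0..1}"
  shows "psi p s \<in> {0..1}"
proof -
  obtain m r where p: "p = (m, r)" and r: "0 \<le> r" and m: "0 < m" "m \<le> r + 1"
    using assms(1) by (auto simp: param_set_def)
  define u where "u = 1 - s"
  have u: "0 \<le> u" "u \<le> 1" using assms(2) by (auto simp: u_def)
  have "m * u \<le> (r + 1) * u"
    using m u by (intro mult_right_mono) auto
  also have "\<dots> \<le> 1 + r * u"
    using u by (simp add: algebra_simps)
  finally have le: "m * u \<le> 1 + r * u" .
  have "0 < 1 + r * u"
    using r u by (simp add: add_pos_nonneg)
  with le m u have "0 \<le> m * u / (1 + r * u)" "m * u / (1 + r * u) \<le> 1"
    by auto
  then show ?thesis
    by (simp add: p u_def)
qed

text \<open>
  In terms of \<open>u = 1 - s\<close> this is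
  \<open>m' v / (1 + r' v) = m m' u / (1 + (r + r' m) u)\<close> with \<open>v = m u / (1 + r u)\<close>.
\<close>

lemma psi_psi:
  assumes "(m, r) \<in> param_set" and "(m', r') \<in> param_set" and "s \<in> {0..1}"
  shows "psi (m', r') (psi (m, r) s) = psi ((m, r) \<star> (m', r')) s"
proof -
  define u where "u = 1 - s"
  have u: "0 \<le> u" using assms(3) by (auto simp: u_def)
  have "0 \<le> r" "0 < m" "0 \<le> r'" using assms by (auto simp: param_set_def)
  then have d: "0 < 1 + r * u" "0 < 1 + (r + r' * m) * u"
    using u by (auto intro!: add_pos_nonneg mult_nonneg_nonneg add_nonneg_nonneg)
  have "1 + r' * (m * (u / (1 + r * u))) = (1 + (r + r' * m) * u) / (1 + r * u)"
    using d by (simp add: field_simps)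
  then have "m' * (m * (u / (1 + r * u)) / (1 + r' * (m * (u / (1 + r * u)))))
      = m * m' * (u / (1 + (r + r' * m) * u))"
    using d by simp
  then show ?thesis
    by (simp add: u_def)
qed

section \<open>Generating functions determine distributions\<close>

text \<open>
  The law of total expectation with respect to the countable partition into the events \<open>X = n\<close>.
\<close>

lemma (in prob_space) expectation_sums_levels:
  fixes f :: "'a \<Rightarrow> real"
  assumes X: "X \<in> measurable M (count_space UNIV)" and f: "integrable M f"
  shows "(\<lambda>n::nat. expectation (\<lambda>\<omega>. indicator {n} (X \<omega>) * f \<omega>)) sums expectation f"
proof -
  note [measurable] = X borel_measurable_integrable[OF f]
  have int: "integrable M (\<lambda>\<omega>. indicator {k} (X \<omega>) * f \<omega>)" for k
    by (rule Bochner_Integration.integrable_bound[OF f]) (auto simp: indicator_def)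
  have levels: "(\<Sum>k<n. indicator {k} (X \<omega>) * f \<omega>) = indicator {..<n} (X \<omega>) * f \<omega>" for n \<omega>
    by (simp add: indicator_def flip: sum_distrib_right)
  have partial: "(\<Sum>k<n. expectation (\<lambda>\<omega>. indicator {k} (X \<omega>) * f \<omega>))
      = expectation (\<lambda>\<omega>. indicator {..<n} (X \<omega>) * f \<omega>)" for n
    unfolding levels[symmetric] by (intro Bochner_Integration.integral_sum[symmetric] int)
  have "(\<lambda>n. expectation (\<lambda>\<omega>. indicator {..<n} (X \<omega>) * f \<omega>)) \<longlonglongrightarrow> expectation f"
  proof (rule integral_dominated_convergence[where w = "\<lambda>\<omega>. norm (f \<omega>)"])
    have "(\<lambda>n. indicator {..<n} (X \<omega>) * f \<omega>) \<longlonglongrightarrow> f \<omega>" for \<omega>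
      by (rule tendsto_eventually, rule eventually_mono[OF eventually_gt_at_top[of "X \<omega>"]]) simp
    then show "AE \<omega> in M. (\<lambda>n. indicator {..<n} (X \<omega>) * f \<omega>) \<longlonglongrightarrow> f \<omega>"
      by simp
  qed (use f in \<open>auto simp: indicator_def\<close>)
  then show ?thesis
    by (simp add: sums_def partial)
qed

lemma (in prob_space) integrable_power_unit_interval:
  assumes [measurable]: "X \<in> measurable M (count_space UNIV)" and "(s::real) \<in> {0..1}"
  shows "integrable M (\<lambda>\<omega>. s ^ X \<omega>)"
  by (rule integrable_const_bound[where B = 1]) (use assms(2) in \<open>auto simp: power_le_one\<close>)

lemma (in prob_space) pgf_sums:
  assumes X[measurable]: "X \<in> measurable M (count_space UNIV)" and s: "s \<in> {0..1}"
  shows "(\<lambda>n. prob (X -` {n} \<inter> space M) * s ^ n) sums pgf M X s"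
proof -
  have "expectation (\<lambda>\<omega>. indicator {n} (X \<omega>) * s ^ X \<omega>) = prob (X -` {n} \<inter> space M) * s ^ n" for n
  proof -
    have "expectation (\<lambda>\<omega>. indicator {n} (X \<omega>) * s ^ X \<omega>)
        = expectation (\<lambda>\<omega>. indicator (X -` {n} \<inter> space M) \<omega> * s ^ n)"
      by (rule Bochner_Integration.integral_cong) (auto simp: indicator_def)
    then show ?thesis
      by simp
  qed
  then show ?thesis
    using expectation_sums_levels[OF X integrable_power_unit_interval[OF X s]]
    by (simp add: pgf_def)
qed

text \<open>
  The zeros of a nontrivial power series do not accumulate at the origin, so values on the positive
  side of the origin already determine the coefficients.
\<close>

lemma power_series_zero_imp_coeff_zero:
  fixes a :: "nat \<Rightarrow> real"
  assumes zero: "\<And>s. s \<in> {0..1} \<Longrightarrow> (\<lambda>n. a n * s ^ n) sums 0"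
  shows "a n = 0"
proof (rule ccontr)
  assume n: "a n \<noteq> 0"
  define f where "f x = (\<Sum>n. a n * x ^ n)" for x
  have f0: "f s = 0" if "s \<in> {0..1}" for s
    using zero[OF that] by (simp add: f_def sums_iff)
  have "a 0 = 0"
    using zero[of 0] powser_sums_zero[of a] sums_unique2 by fastforce
  with n have "n > 0" by (cases n) auto
  have sums: "(\<lambda>n. a n * (x - 0) ^ n) sums f x" if "norm (x - 0) < 1" for x
  proof -
    have "summable (\<lambda>n. a n * 1 ^ n)"
      using zero[of 1] by (simp add: sums_iff)
    from powser_inside[OF this, of x] that show ?thesis
      by (simp add: f_def summable_sums)
  qed
  obtain s where "0 < s" and s: "\<And>z. z \<in> cball 0 s - {0} \<Longrightarrow> f z \<noteq> 0"
    using powser_0_nonzero[of 1 0 a f n, OF _ sums _ n \<open>n > 0\<close>] f0 by auto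
  moreover have "f (min s 1) = 0"
    using \<open>0 < s\<close> by (intro f0) auto
  moreover have "min s 1 \<in> cball 0 s - {0}"
    using \<open>0 < s\<close> by auto
  ultimately show False by blast
qed

lemma (in prob_space) distr_eqI_pgf:
  assumes X[measurable]: "X \<in> measurable M (count_space UNIV)"
    and Y[measurable]: "Y \<in> measurable M (count_space UNIV)"
    and eq: "\<And>s. s \<in> {0..1} \<Longrightarrow> pgf M X s = pgf M Y s"
  shows "distr M (count_space UNIV) X = distr M (count_space UNIV) Y"
proof (rule measure_eqI_countable[of _ UNIV])
  fix n :: nat
  have "prob (X -` {n} \<inter> space M) - prob (Y -` {n} \<inter> space M) = 0"
  proof (rule power_series_zero_imp_coeff_zero)
    fix s :: real assume s: "s \<in> {0..1}"
    show "(\<lambda>n. (prob (X -` {n} \<inter> space M) - prob (Y -` {n} \<inter> space M)) * s ^ n) sums 0"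
      using sums_diff[OF pgf_sums[OF X s] pgf_sums[OF Y s]] eq[OF s]
      by (simp add: left_diff_distrib)
  qed
  then show "emeasure (distr M (count_space UNIV) X) {n} = emeasure (distr M (count_space UNIV) Y) {n}"
    by (simp add: emeasure_distr emeasure_eq_measure)
qed auto

section \<open>Thinning composes generating functions\<close>

lemma (in prob_space) thinning_seq_measurable:
  assumes "thinning_seq M p X Z"
  shows "Z i \<in> measurable M (count_space UNIV)"
  using assms by (auto simp: thinning_seq_def iid_def indep_vars_def)

lemma measurable_thin:
  assumes X[measurable]: "X \<in> measurable M (count_space UNIV)"
    and Z[measurable]: "\<And>i. Z i \<in> measurable M (count_space UNIV)"
  shows "thin Z X \<in> measurable M (count_space UNIV)"
proof -
  have "(\<lambda>\<omega>. \<Sum>i<n. Z i \<omega>) \<in> measurable M (count_space UNIV)" for n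
    by measurable
  from measurable_compose_countable[OF this X] show ?thesis
    by (simp add: thin_def[abs_def])
qed

lemma (in prob_space) expectation_power_sum_iid:
  assumes Z: "thinning_seq M p X Z" and s: "s \<in> {0..1}"
  shows "expectation (\<lambda>\<omega>. s ^ (\<Sum>i<n. Z i \<omega>)) = psi p s ^ n"
proof -
  have "indep_vars (\<lambda>_. count_space UNIV) Z {..<n}"
    using Z by (auto simp: thinning_seq_def iid_def intro: indep_vars_subset)
  then have "indep_vars (\<lambda>_. borel) (\<lambda>i \<omega>. s ^ Z i \<omega>) {..<n}"
    by (rule indep_vars_compose2) simp
  then have "expectation (\<lambda>\<omega>. \<Prod>i<n. s ^ Z i \<omega>) = (\<Prod>i<n. expectation (\<lambda>\<omega>. s ^ Z i \<omega>))"
    using s by (intro indep_vars_lebesgue_integral)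
      (auto intro: integrable_power_unit_interval thinning_seq_measurable[OF Z])
  also have "\<dots> = psi p s ^ n"
    using Z s by (simp add: thinning_seq_def pgf_def)
  finally show ?thesis
    by (simp add: power_sum)
qed

lemma Int_stable_vimages: "Int_stable {f -` A \<inter> S | A. A \<in> sets N}"
proof (rule Int_stableI)
  fix a b
  assume "a \<in> {f -` A \<inter> S | A. A \<in> sets N}" "b \<in> {f -` A \<inter> S | A. A \<in> sets N}"
  then obtain A B where "A \<in> sets N" "B \<in> sets N" "a = f -` A \<inter> S" "b = f -` B \<inter> S"
    by blast
  then show "a \<inter> b \<in> {f -` A \<inter> S | A. A \<in> sets N}"
    by (intro CollectI exI[of _ "A \<inter> B"]) auto
qed

text \<open>
  Independence of \<open>X\<close> from the whole process \<open>Z\<close> yields independence of any two real-valued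
  statistics, one of \<open>X\<close> and the other of \<open>Z\<close>, to which the product rule for expectations applies.
\<close>

lemma (in prob_space) thinning_seq_indep_var:
  fixes g :: "nat \<Rightarrow> real" and h :: "(nat \<Rightarrow> nat) \<Rightarrow> real"
  assumes X[measurable]: "X \<in> measurable M (count_space UNIV)" and Z: "thinning_seq M p X Z"
    and h[measurable]: "h \<in> borel_measurable (Pi\<^sub>M UNIV (\<lambda>_. count_space UNIV))"
  shows "indep_var borel (\<lambda>\<omega>. g (X \<omega>)) borel (\<lambda>\<omega>. h (\<lambda>i. Z i \<omega>))"
proof -
  let ?P = "Pi\<^sub>M UNIV (\<lambda>_. count_space UNIV) :: (nat \<Rightarrow> nat) measure"
  note [measurable] = thinning_seq_measurable[OF Z]
  have Z': "(\<lambda>\<omega> i. Z i \<omega>) \<in> measurable M ?P"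
    by (rule measurable_PiM_single') auto
  have hZ: "(\<lambda>\<omega>. h (\<lambda>i. Z i \<omega>)) \<in> borel_measurable M"
    using measurable_compose[OF Z' h] .
  have indep: "indep_set
       {X -` A \<inter> space M | A. A \<in> sets (count_space UNIV)}
       {(\<lambda>\<omega> i. Z i \<omega>) -` B \<inter> space M | B. B \<in> sets ?P}"
    using Z by (simp add: thinning_seq_def)
  have "prob ((\<lambda>\<omega>. g (X \<omega>)) -` A \<inter> space M \<inter> ((\<lambda>\<omega>. h (\<lambda>i. Z i \<omega>)) -` B \<inter> space M))
      = prob ((\<lambda>\<omega>. g (X \<omega>)) -` A \<inter> space M) * prob ((\<lambda>\<omega>. h (\<lambda>i. Z i \<omega>)) -` B \<inter> space M)"
    if "A \<in> sets borel" "B \<in> sets borel" for A B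
  proof (rule indep_setD[OF indep])
    show "(\<lambda>\<omega>. g (X \<omega>)) -` A \<inter> space M \<in> {X -` A \<inter> space M | A. A \<in> sets (count_space UNIV)}"
      by (auto intro!: exI[of _ "g -` A"])
    have "h -` B \<in> sets ?P"
      using measurable_sets[OF h that(2)] by (simp add: space_PiM)
    then show "(\<lambda>\<omega>. h (\<lambda>i. Z i \<omega>)) -` B \<inter> space M \<in> {(\<lambda>\<omega> i. Z i \<omega>) -` B \<inter> space M | B. B \<in> sets ?P}"
      by (auto intro!: exI[of _ "h -` B"])
  qed
  then have "indep_set {(\<lambda>\<omega>. g (X \<omega>)) -` A \<inter> space M | A. A \<in> sets borel}
      {(\<lambda>\<omega>. h (\<lambda>i. Z i \<omega>)) -` B \<inter> space M | B. B \<in> sets borel}"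
    using hZ by (intro indep_setI) (auto intro: measurable_sets)
  then have "indep_set
      (sigma_sets (space M) {(\<lambda>\<omega>. g (X \<omega>)) -` A \<inter> space M | A. A \<in> sets borel})
      (sigma_sets (space M) {(\<lambda>\<omega>. h (\<lambda>i. Z i \<omega>)) -` B \<inter> space M | B. B \<in> sets borel})"
    by (rule indep_set_sigma_sets) (rule Int_stable_vimages)+
  then show ?thesis
    using hZ by (simp add: indep_var_eq)
qed

text \<open>
  Both sides are sums over \<open>n\<close> of the contributions of the event \<open>X = n\<close>, and these contributions
  agree because on that event the random number of summands is the constant \<open>n\<close>.
\<close>

lemma (in prob_space) pgf_thin:
  assumes X[measurable]: "X \<in> measurable M (count_space UNIV)" and Z: "thinning_seq M p X Z"
    and p: "p \<in> param_set" and s: "s \<in> {0..1}"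
  shows "pgf M (thin Z X) s = pgf M X (psi p s)"
proof -
  note Zm[measurable] = thinning_seq_measurable[OF Z]
  have level: "expectation (\<lambda>\<omega>. indicator {n} (X \<omega>) * s ^ thin Z X \<omega>)
      = prob (X -` {n} \<inter> space M) * psi p s ^ n" for n
  proof -
    have "indep_var borel (\<lambda>\<omega>. indicator {n} (X \<omega>)) borel (\<lambda>\<omega>. s ^ (\<Sum>i<n. Z i \<omega>))"
      by (rule thinning_seq_indep_var[OF X Z, where h = "\<lambda>z. s ^ (\<Sum>i<n. z i)"]) measurable
    moreover have "integrable M (\<lambda>\<omega>. indicator {n} (X \<omega>) :: real)"
      by (rule integrable_const_bound[where B = 1]) (auto simp: indicator_def)
    moreover have "integrable M (\<lambda>\<omega>. s ^ (\<Sum>i<n. Z i \<omega>))"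
      using s by (intro integrable_power_unit_interval) measurable
    ultimately have "expectation (\<lambda>\<omega>. indicator {n} (X \<omega>) * s ^ (\<Sum>i<n. Z i \<omega>))
        = expectation (\<lambda>\<omega>. indicator {n} (X \<omega>)) * expectation (\<lambda>\<omega>. s ^ (\<Sum>i<n. Z i \<omega>))"
      by (rule indep_var_lebesgue_integral)
    moreover have "expectation (\<lambda>\<omega>. indicator {n} (X \<omega>) * s ^ (\<Sum>i<n. Z i \<omega>))
        = expectation (\<lambda>\<omega>. indicator {n} (X \<omega>) * s ^ thin Z X \<omega>)"
      by (rule Bochner_Integration.integral_cong) (auto simp: indicator_def thin_def)
    moreover have "expectation (\<lambda>\<omega>. indicator {n} (X \<omega>)) = prob (X -` {n} \<inter> space M)"
    proof -
      have "expectation (\<lambda>\<omega>. indicator {n} (X \<omega>)) = expectation (indicat_real (X -` {n} \<inter> space M))"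
        by (rule Bochner_Integration.integral_cong) (auto simp: indicator_def)
      then show ?thesis by simp
    qed
    ultimately show ?thesis
      by (simp add: expectation_power_sum_iid[OF Z s])
  qed
  have "integrable M (\<lambda>\<omega>. s ^ thin Z X \<omega>)"
    using measurable_thin[OF X Zm] s by (rule integrable_power_unit_interval)
  from expectation_sums_levels[OF X this]
  have "(\<lambda>n. prob (X -` {n} \<inter> space M) * psi p s ^ n) sums pgf M (thin Z X) s"
    by (simp add: level pgf_def)
  with pgf_sums[OF X psi_in_unit_interval[OF p s]] show ?thesis
    by (metis sums_unique2)
qed

section \<open>Composition of two thinnings\<close>

theorem proposition2p4:
  fixes M :: "'a measure"
    and X :: "'a \<Rightarrow> nat"
    and Z Z' W :: "nat \<Rightarrow> 'a \<Rightarrow> nat"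
    and m r m' r' :: real
  assumes "prob_space M"
    and "X \<in> measurable M (count_space UNIV)"
    and "(m, r) \<in> param_set"
    and "(m', r') \<in> param_set"
    and "thinning_seq M (m', r') X Z'"
    and "thinning_seq M (m, r) (thin Z' X) Z"
    and "thinning_seq M ((m, r) \<star> (m', r')) X W"
  shows "distr M (count_space UNIV) (thin Z (thin Z' X)) =
         distr M (count_space UNIV) (thin W X)"
proof -
  interpret prob_space M by fact
  note X = assms(2) and p = assms(3) and p' = assms(4)
    and Z' = assms(5) and Z = assms(6) and W = assms(7)
  have Y: "thin Z' X \<in> measurable M (count_space UNIV)"
    by (rule measurable_thin[OF X thinning_seq_measurable[OF Z']])
  show ?thesis
  proof (rule distr_eqI_pgf)
    show "thin Z (thin Z' X) \<in> measurable M (count_space UNIV)"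
      by (rule measurable_thin[OF Y thinning_seq_measurable[OF Z]])
    show "thin W X \<in> measurable M (count_space UNIV)"
      by (rule measurable_thin[OF X thinning_seq_measurable[OF W]])
    fix s :: real assume s: "s \<in> {0..1}"
    have "pgf M (thin Z (thin Z' X)) s = pgf M (thin Z' X) (psi (m, r) s)"
      by (rule pgf_thin[OF Y Z p s])
    also have "\<dots> = pgf M X (psi (m', r') (psi (m, r) s))"
      by (rule pgf_thin[OF X Z' p' psi_in_unit_interval[OF p s]])
    also have "\<dots> = pgf M X (psi ((m, r) \<star> (m', r')) s)"
      by (simp only: psi_psi[OF p p' s])
    also have "\<dots> = pgf M (thin W X) s"
      by (rule pgf_thin[OF X W param_mult_closed[OF p p'] s, symmetric])
    finally show "pgf M (thin Z (thin Z' X)) s = pgf M (thin W X) s" .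
  qed
qed

end
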